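(* Let $F=\hat f+\tau\hat g$ on $\mathcal{R}^n$. Let $\{\alpha_k\}_{k=0}^\infty$ be a sequence with $\alpha_k\in(0,1)$ for all $k$ and $\sum_{k=0}^\infty\alpha_k=\infty$, let $\{y_k\}_{k=0}^\infty$ be an arbitrary sequence in $\mathcal{R}^n$, and let $\phi_0:\mathcal{R}^n\to\mathcal{R}$. Let $\lambda_0=1$, and assume that the estimates $L_k>0$ of the Lipschitz constant $L_{\hat f}$ are selected so that the quadratic upper bound holds at the iterates, i.e. for all $k\ge 0$, with $x_{k+1}=T_{L_k}(y_k)$, $$\hat f(x_{k+1})\le\hat f(y_k)+\nabla\hat f(y_k)^T(x_{k+1}-y_k)+\frac{L_k}{2}\|x_{k+1}-y_k\|^2 .$$ Then the sequences $\{\phi_k\}_{k=0}^\infty$ and $\{\lambda_k\}_{k=0}^\infty$ defined recursively by $$\lambda_{k+1}=(1-\alpha_k)\lambda_k,$$ $$\phi_{k+1}(x)=(1-\alpha_k)\phi_k(x)+\alpha_k\left(F(T_{L_k}(y_k))+\frac{1}{2L_k}\|r_{L_k}(y_k)\|^2\right)+\alpha_k\left(r_{L_k}(y_k)^T(x-y_k)+\frac{\mu_{\hat f}}{2}\|x-y_k\|^2\right)$$ are estimating sequences of $F$.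
   Context: $\|\cdot\|$ is the Euclidean norm. $F=\hat f+\tau\hat g$ with $\tau>0$, $\hat f:\mathcal{R}^n\to\mathcal{R}$ $L_{\hat f}$-smooth (differentiable with $L_{\hat f}$-Lipschitz gradient) and $\mu_{\hat f}$-strongly convex, $0\le\mu_{\hat f}\le L_{\hat f}$, and $\hat g:\mathcal{R}^n\to\mathcal{R}$ convex and lower semi-continuous. For $L>0$: $m_L(y;x)=\hat f(y)+\nabla\hat f(y)^T(x-y)+\frac L2\|x-y\|^2+\tau\hat g(x)$; $T_L(y)=\arg\min_{x\in\mathcal{R}^n}m_L(y;x)$; $r_L(y)=L(y-T_L(y))$. Estimating sequences: functions $\phi_k:\mathcal{R}^n\to\mathcal{R}$ and reals $\lambda_k\ge0$ are estimating sequences of $F$ if $\lambda_k\to0$ as $k\to\infty$ and $\phi_k(x)\le\lambda_k\phi_0(x)+(1-\lambda_k)F(x)$ for all $x\in\mathcal{R}^n$, $k\ge0$. *)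

theory Defs
  imports "HOL-Analysis.Analysis"
begin

text \<open>Unique whenever \<open>f\<close> is differentiable at \<open>x\<close>; unspecified otherwise.\<close>
definition grad :: "('a::real_inner \<Rightarrow> real) \<Rightarrow> 'a \<Rightarrow> 'a" where
  "grad f x = (THE D. GDERIV f x :> D)"

definition smooth_with :: "real \<Rightarrow> ('a::real_inner \<Rightarrow> real) \<Rightarrow> bool" where
  "smooth_with L f \<longleftrightarrow> (\<forall>x. f differentiable (at x)) \<and> L-lipschitz_on UNIV (grad f)"

text \<open>The modulus \<open>\<mu> = 0\<close> is allowed and gives plain convexity.\<close>
definition strongly_convex :: "real \<Rightarrow> ('a::real_normed_vector \<Rightarrow> real) \<Rightarrow> bool" where
  "strongly_convex \<mu> f \<longleftrightarrow>
     (\<forall>x y. \<forall>u\<ge>0. \<forall>v\<ge>0. u + v = 1 \<longrightarrow>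
        f (u *\<^sub>R x + v *\<^sub>R y) \<le> u * f x + v * f y - \<mu> / 2 * u * v * (norm (x - y))\<^sup>2)"

definition lower_semicontinuous :: "('a::topological_space \<Rightarrow> real) \<Rightarrow> bool" where
  "lower_semicontinuous f \<longleftrightarrow> (\<forall>x. \<forall>a < f x. \<forall>\<^sub>F z in nhds x. a < f z)"

definition composite_model ::
    "('a::real_inner \<Rightarrow> real) \<Rightarrow> real \<Rightarrow> ('a \<Rightarrow> real) \<Rightarrow> real \<Rightarrow> 'a \<Rightarrow> 'a \<Rightarrow> real" where
  "composite_model f \<tau> g L y x =
     f y + grad f y \<bullet> (x - y) + L / 2 * (norm (x - y))\<^sup>2 + \<tau> * g x"

definition grad_step ::
    "('a::real_inner \<Rightarrow> real) \<Rightarrow> real \<Rightarrow> ('a \<Rightarrow> real) \<Rightarrow> real \<Rightarrow> 'a \<Rightarrow> 'a" where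
  "grad_step f \<tau> g L y = (ARG_MIN (composite_model f \<tau> g L y) x. True)"

definition reduced_grad ::
    "('a::real_inner \<Rightarrow> real) \<Rightarrow> real \<Rightarrow> ('a \<Rightarrow> real) \<Rightarrow> real \<Rightarrow> 'a \<Rightarrow> 'a" where
  "reduced_grad f \<tau> g L y = L *\<^sub>R (y - grad_step f \<tau> g L y)"

definition estimating_sequences ::
    "(nat \<Rightarrow> 'a \<Rightarrow> real) \<Rightarrow> (nat \<Rightarrow> real) \<Rightarrow> ('a \<Rightarrow> real) \<Rightarrow> bool" where
  "estimating_sequences \<phi> lam F \<longleftrightarrow>
     (\<forall>k. 0 \<le> lam k) \<and> lam \<longlonglongrightarrow> 0 \<and>
     (\<forall>x k. \<phi> k x \<le> lam k * \<phi> 0 x + (1 - lam k) * F x)"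

end

theory Submission
  imports Defs
begin

text \<open>
  The argument rests on one lower bound for \<open>F = f + \<tau> g\<close>, valid for every base point \<open>y\<close> and every
  step length parameter \<open>L\<close> satisfying the quadratic upper bound: with \<open>T = T\<^sub>L(y)\<close> and
  \<open>r = L (y - T)\<close>,
  \<open>F(x) \<ge> F(T) + |r|\<^sup>2 / (2 L) + r \<bullet> (x - y) + \<mu>/2 |x - y|\<^sup>2\<close> for all \<open>x\<close>
  (lemma \<open>composite_lower_bound\<close>).  The recursion for \<open>\<phi>\<close> mixes \<open>\<phi> k\<close> with exactly this lower bound
  of \<open>F\<close>, so an induction on \<open>k\<close> gives \<open>\<phi> k \<le> \<lambda> k \<phi> 0 + (1 - \<lambda> k) F\<close>.

  The lower bound is the sum of two first-order inequalities.  For \<open>f\<close> it is the tangent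
  paraboloid at \<open>y\<close> (\<open>strongly_convex_imp_above_paraboloid\<close>).  For \<open>g\<close> it is the optimality condition
  of the model at its minimizer: \<open>r - \<nabla>f(y)\<close> is a subgradient of \<open>\<tau> g\<close> at \<open>T\<close>
  (\<open>model_minimizer_subgradient\<close>).  Adding them, the terms with \<open>\<nabla>f(y)\<close> combine to the linearization
  of \<open>f\<close> around \<open>y\<close> taken at \<open>T\<close>, which the quadratic upper bound compares with \<open>f(T)\<close>; the loss \<open>L/2 |T - y|\<^sup>2\<close> is
  half of the gain \<open>r \<bullet> (y - T) = |r|\<^sup>2 / L\<close>.

  Since the step is the choice of some minimizer, the model must be shown to possess one: a
  finite convex function falls at most linearly along rays, so the quadratic term makes the
  model coercive.  Finally \<open>\<lambda> k \<le> exp (- (\<Sum>i<k. \<alpha> i))\<close> tends to \<open>0\<close>.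
\<close>

section \<open>First-order bounds\<close>

text \<open>
  The derivative is a linear functional, which in finite dimension is the inner product with
  the image of \<open>1\<close> under its adjoint; so the definite description in \<open>grad\<close> has a unique witness.
\<close>
lemma differentiable_imp_GDERIV_grad:
  fixes f :: "'a::euclidean_space \<Rightarrow> real"
  assumes "f differentiable (at x)"
  shows "GDERIV f x :> grad f x"
proof -
  obtain D where D: "(f has_derivative D) (at x)"
    using assms unfolding differentiable_def by blast
  have "linear D"
    using D by (rule has_derivative_linear)
  then have "D = (\<lambda>h. h \<bullet> adjoint D 1)"
    by (intro ext) (simp add: adjoint_works)
  then have ex: "GDERIV f x :> adjoint D 1"
    using D unfolding gderiv_def by simp
  moreover have "E = adjoint D 1" if "GDERIV f x :> E" for E
  proof -
    have "(\<lambda>h. h \<bullet> E) = (\<lambda>h. h \<bullet> adjoint D 1)"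
      using that ex unfolding gderiv_def by (rule has_derivative_unique)
    then have "\<forall>h. h \<bullet> E = h \<bullet> adjoint D 1"
      unfolding fun_eq_iff .
    then show ?thesis
      by (simp add: vector_eq_ldot)
  qed
  ultimately show ?thesis
    unfolding grad_def by (rule theI)
qed

text \<open>
  Strong convexity on the segment from \<open>y\<close> to \<open>x\<close> bounds the difference quotient at \<open>y\<close> with step
  \<open>t\<close> by \<open>f x - f y - \<mu>/2 (1 - t) |x - y|\<^sup>2\<close>; the bound is the limit \<open>t \<rightarrow> 0\<close>.
\<close>
lemma strongly_convex_imp_above_paraboloid:
  fixes f :: "'a::euclidean_space \<Rightarrow> real"
  assumes conv: "strongly_convex \<mu> f" and diff: "f differentiable (at y)"
  shows "f y + grad f y \<bullet> (x - y) + \<mu> / 2 * (norm (x - y))\<^sup>2 \<le> f x"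
proof -
  define d where "d = x - y"
  have "(f has_derivative (\<lambda>h. h \<bullet> grad f y)) (at (y + 0 *\<^sub>R d))"
    using differentiable_imp_GDERIV_grad[OF diff] by (simp add: gderiv_def)
  moreover have "((\<lambda>t. y + t *\<^sub>R d) has_derivative (\<lambda>t. t *\<^sub>R d)) (at 0)"
    by (auto intro!: derivative_eq_intros)
  ultimately have "((\<lambda>t. f (y + t *\<^sub>R d)) has_derivative (\<lambda>t. (t *\<^sub>R d) \<bullet> grad f y)) (at 0)"
    by (rule has_derivative_compose[rotated])
  then have "DERIV (\<lambda>t. f (y + t *\<^sub>R d)) 0 :> grad f y \<bullet> d"
    by (rule has_derivative_imp_has_field_derivative) (simp add: inner_commute[of d])
  then have lim: "((\<lambda>t. (f (y + t *\<^sub>R d) - f y) / t) \<longlongrightarrow> grad f y \<bullet> d) (at_right 0)"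
    by (simp add: DERIV_def filterlim_at_split)
  have lim': "((\<lambda>t. f x - f y - \<mu> / 2 * (1 - t) * (norm d)\<^sup>2)
      \<longlongrightarrow> f x - f y - \<mu> / 2 * (1 - 0) * (norm d)\<^sup>2) (at_right 0)"
    by (intro tendsto_intros)
  have "(f (y + t *\<^sub>R d) - f y) / t \<le> f x - f y - \<mu> / 2 * (1 - t) * (norm d)\<^sup>2"
    if t: "0 < t" "t < 1" for t
  proof -
    have "y + t *\<^sub>R d = t *\<^sub>R x + (1 - t) *\<^sub>R y"
      by (simp add: d_def algebra_simps)
    moreover have "f (t *\<^sub>R x + (1 - t) *\<^sub>R y)
        \<le> t * f x + (1 - t) * f y - \<mu> / 2 * t * (1 - t) * (norm d)\<^sup>2"
      using conv t unfolding strongly_convex_def d_def by simp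
    ultimately have "f (y + t *\<^sub>R d) - f y
        \<le> t * f x + (1 - t) * f y - \<mu> / 2 * t * (1 - t) * (norm d)\<^sup>2 - f y"
      by simp
    also have "\<dots> = t * (f x - f y - \<mu> / 2 * (1 - t) * (norm d)\<^sup>2)"
      by (simp add: algebra_simps)
    finally have "f (y + t *\<^sub>R d) - f y \<le> t * (f x - f y - \<mu> / 2 * (1 - t) * (norm d)\<^sup>2)" .
    then show ?thesis
      using t by (simp add: divide_le_eq mult.commute)
  qed
  then have "\<forall>\<^sub>F t in at_right 0. (f (y + t *\<^sub>R d) - f y) / t
      \<le> f x - f y - \<mu> / 2 * (1 - t) * (norm d)\<^sup>2"
    unfolding eventually_at_right_field by (intro exI[of _ 1]) auto
  from tendsto_le[OF _ lim' lim this] show ?thesis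
    by (simp add: d_def)
qed

section \<open>Minimizers of the composite model\<close>

text \<open>
  A point at distance \<open>t \<ge> 1\<close> from \<open>y\<close> sees the unit ball around \<open>y\<close> through the convex combination
  with weight \<open>1/t\<close>, and \<open>g\<close> attains a minimum on that ball; so \<open>g\<close> cannot fall faster than linearly.
\<close>
lemma convex_linear_decrease:
  fixes g :: "'a::euclidean_space \<Rightarrow> real"
  assumes conv: "convex_on UNIV g"
  obtains C where "0 \<le> C" "\<And>x. 1 \<le> norm (x - y) \<Longrightarrow> g y - C * norm (x - y) \<le> g x"
proof -
  have "continuous_on (cball y 1) g"
    using convex_on_continuous[OF open_UNIV conv] continuous_on_subset by blast
  moreover have "cball y 1 \<noteq> {}"
    by simp
  ultimately obtain z where z: "\<And>w. w \<in> cball y 1 \<Longrightarrow> g z \<le> g w"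
    using continuous_attains_inf[OF compact_cball] by blast
  have "g y - (g y - g z) * norm (x - y) \<le> g x" if "1 \<le> norm (x - y)" for x
  proof -
    define t where "t = norm (x - y)"
    have t: "1 \<le> t"
      using that by (simp add: t_def)
    define w where "w = (1 - 1 / t) *\<^sub>R y + (1 / t) *\<^sub>R x"
    have "w - y = (1 / t) *\<^sub>R (x - y)"
      by (simp add: w_def algebra_simps)
    then have "norm (w - y) = 1"
      using t by (simp flip: t_def)
    then have "g z \<le> g w"
      by (intro z) (simp add: dist_norm norm_minus_commute)
    also have "g w \<le> (1 - 1 / t) * g y + (1 / t) * g x"
      unfolding w_def using convex_onD[OF conv, of "1 / t" y x] t by simp
    finally have "t * g z \<le> t * ((1 - 1 / t) * g y + (1 / t) * g x)"
      using t by (intro mult_left_mono) auto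
    also have "\<dots> = (t - 1) * g y + g x"
      using t by (simp add: field_simps)
    finally show ?thesis
      unfolding t_def[symmetric] by (simp add: algebra_simps)
  qed
  then show thesis
    using z[of y] by (intro that[of "g y - g z"]) auto
qed

lemma composite_model_attains_min:
  fixes g :: "'a::euclidean_space \<Rightarrow> real"
  assumes conv: "convex_on UNIV g" and "0 \<le> \<tau>" "0 < L"
  shows "\<exists>T. \<forall>x. composite_model f \<tau> g L y T \<le> composite_model f \<tau> g L y x"
proof -
  let ?m = "composite_model f \<tau> g L y"
  obtain C where C: "0 \<le> C" "\<And>x. 1 \<le> norm (x - y) \<Longrightarrow> g y - C * norm (x - y) \<le> g x"
    using convex_linear_decrease[OF conv] by blast
  \<comment> \<open>Beyond this radius the quadratic term dominates the linear decrease of the other terms.\<close>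
  define R where "R = max 1 (2 * (norm (grad f y) + \<tau> * C) / L)"
  have far: "?m y \<le> ?m x" if "R < norm (x - y)" for x
  proof -
    define t where "t = norm (x - y)"
    have t: "1 \<le> t" "2 * (norm (grad f y) + \<tau> * C) / L \<le> t"
      using that by (auto simp: R_def t_def)
    have "norm (grad f y) + \<tau> * C \<le> L / 2 * t"
      using t(2) \<open>0 < L\<close> by (simp add: field_simps)
    then have "t * (norm (grad f y) + \<tau> * C) \<le> t * (L / 2 * t)"
      using t(1) by (intro mult_left_mono) auto
    moreover have "- (norm (grad f y) * t) \<le> grad f y \<bullet> (x - y)"
      using Cauchy_Schwarz_ineq2[of "grad f y" "x - y"] by (simp add: t_def abs_le_iff)
    moreover have "\<tau> * (g y - C * t) \<le> \<tau> * g x"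
      using C(2)[of x] t(1) \<open>0 \<le> \<tau>\<close> by (intro mult_left_mono) (auto simp: t_def)
    ultimately show ?thesis
      unfolding composite_model_def t_def[symmetric]
      by (simp add: algebra_simps power2_eq_square)
  qed
  have "continuous_on (cball y R) g"
    using convex_on_continuous[OF open_UNIV conv] continuous_on_subset by blast
  then have "continuous_on (cball y R) ?m"
    unfolding composite_model_def by (intro continuous_intros)
  moreover have y: "y \<in> cball y R"
    by (simp add: R_def)
  ultimately obtain T where T: "\<And>x. x \<in> cball y R \<Longrightarrow> ?m T \<le> ?m x"
    using continuous_attains_inf[OF compact_cball] by blast
  have "?m T \<le> ?m x" for x
  proof (cases "x \<in> cball y R")
    case False
    then have "?m y \<le> ?m x"
      by (intro far) (simp add: dist_norm norm_minus_commute)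
    with T[OF y] show ?thesis
      by simp
  qed (rule T)
  then show ?thesis
    by blast
qed

lemma grad_step_minimizes:
  fixes g :: "'a::euclidean_space \<Rightarrow> real"
  assumes "convex_on UNIV g" "0 \<le> \<tau>" "0 < L"
  shows "composite_model f \<tau> g L y (grad_step f \<tau> g L y) \<le> composite_model f \<tau> g L y x"
proof -
  obtain T where "\<And>x. composite_model f \<tau> g L y T \<le> composite_model f \<tau> g L y x"
    using composite_model_attains_min[OF assms] by blast
  then have "is_arg_min (composite_model f \<tau> g L y) (\<lambda>_. True) T"
    by (simp add: is_arg_min_linorder)
  then have "is_arg_min (composite_model f \<tau> g L y) (\<lambda>_. True) (grad_step f \<tau> g L y)"
    unfolding grad_step_def arg_min_def by (rule someI)
  then show ?thesis
    by (simp add: is_arg_min_linorder)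
qed

text \<open>
  Moving from the minimizer \<open>T\<close> a fraction \<open>t\<close> of the way to \<open>x\<close> does not decrease the model.  After
  division by \<open>t\<close>, convexity of \<open>g\<close> makes its contribution independent of \<open>t\<close>, and the limit
  \<open>t \<rightarrow> 0\<close> leaves only the first-order terms.
\<close>
lemma model_minimizer_subgradient:
  fixes g :: "'a::euclidean_space \<Rightarrow> real"
  assumes conv: "convex_on UNIV g" and "0 \<le> \<tau>"
    and min: "\<And>z. composite_model f \<tau> g L y T \<le> composite_model f \<tau> g L y z"
  shows "\<tau> * g T + (L *\<^sub>R (y - T) - grad f y) \<bullet> (x - T) \<le> \<tau> * g x"
proof -
  define d where "d = x - T"
  define a where "a = grad f y \<bullet> d + L * ((T - y) \<bullet> d) + \<tau> * (g x - g T)"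
  have "0 \<le> a + t * (L / 2 * (norm d)\<^sup>2)" if t: "0 < t" "t < 1" for t
  proof -
    let ?z = "T + t *\<^sub>R d"
    have "?z = (1 - t) *\<^sub>R T + t *\<^sub>R x"
      by (simp add: d_def algebra_simps)
    then have "g ?z \<le> (1 - t) * g T + t * g x"
      using convex_onD[OF conv, of t T x] t by simp
    then have "\<tau> * g ?z \<le> \<tau> * ((1 - t) * g T + t * g x)"
      using \<open>0 \<le> \<tau>\<close> by (rule mult_left_mono)
    then have g: "\<tau> * (g ?z - g T) \<le> t * (\<tau> * (g x - g T))"
      by (simp add: algebra_simps)
    have sq: "(norm (?z - y))\<^sup>2 = (norm (T - y))\<^sup>2 + 2 * t * ((T - y) \<bullet> d) + t\<^sup>2 * (norm d)\<^sup>2"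
      unfolding power2_norm_eq_inner
      by (simp add: inner_simps inner_commute algebra_simps power2_eq_square)
    have lin: "grad f y \<bullet> (?z - y) = grad f y \<bullet> (T - y) + t * (grad f y \<bullet> d)"
      by (simp add: inner_simps)
    have "0 \<le> composite_model f \<tau> g L y ?z - composite_model f \<tau> g L y T"
      using min[of ?z] by simp
    also have "\<dots> = t * (grad f y \<bullet> d + L * ((T - y) \<bullet> d) + t * (L / 2 * (norm d)\<^sup>2))
        + \<tau> * (g ?z - g T)"
      unfolding composite_model_def sq lin by (simp add: field_simps power2_eq_square)
    also have "\<dots> \<le> t * (a + t * (L / 2 * (norm d)\<^sup>2))"
      using g by (simp add: a_def distrib_left)
    finally have "0 \<le> t * (a + t * (L / 2 * (norm d)\<^sup>2))" .
    then show ?thesis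
      using t by (simp add: zero_le_mult_iff)
  qed
  then have "\<forall>\<^sub>F t in at_right 0. 0 \<le> a + t * (L / 2 * (norm d)\<^sup>2)"
    unfolding eventually_at_right_field by (intro exI[of _ 1]) auto
  moreover have "((\<lambda>t. a + t * (L / 2 * (norm d)\<^sup>2)) \<longlongrightarrow> a + 0 * (L / 2 * (norm d)\<^sup>2)) (at_right 0)"
    by (intro tendsto_intros)
  ultimately have "0 \<le> a + 0 * (L / 2 * (norm d)\<^sup>2)"
    by (intro tendsto_lowerbound) auto
  then show ?thesis
    by (simp add: a_def d_def inner_simps algebra_simps)
qed

section \<open>The lower bound and the estimating sequences\<close>

text \<open>
  The paraboloid below \<open>f\<close> is anchored at \<open>y\<close> and the subgradient inequality for \<open>\<tau> g\<close> at \<open>T\<close>.  Moving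
  the anchor of the linear term \<open>r\<close> from \<open>T\<close> to \<open>y\<close> gains \<open>L |T - y|\<^sup>2\<close>; half of it pays for replacing the
  linearization of \<open>f\<close> by \<open>f T\<close>, and the other half is the term \<open>|r|\<^sup>2 / (2 L)\<close>.
\<close>
lemma composite_lower_bound:
  fixes f g :: "'a::euclidean_space \<Rightarrow> real"
  assumes "f differentiable (at y)" "strongly_convex \<mu> f" "convex_on UNIV g" "0 \<le> \<tau>" "0 < L"
  defines "T \<equiv> grad_step f \<tau> g L y" and "r \<equiv> reduced_grad f \<tau> g L y"
  assumes upper: "f T \<le> f y + grad f y \<bullet> (T - y) + L / 2 * (norm (T - y))\<^sup>2"
  shows "f T + \<tau> * g T + 1 / (2 * L) * (norm r)\<^sup>2 + (r \<bullet> (x - y) + \<mu> / 2 * (norm (x - y))\<^sup>2)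
      \<le> f x + \<tau> * g x"
proof -
  have r: "r = L *\<^sub>R (y - T)"
    by (simp add: r_def T_def reduced_grad_def)
  have "\<tau> * g T + (r - grad f y) \<bullet> (x - T) \<le> \<tau> * g x"
    unfolding r T_def using assms
    by (intro model_minimizer_subgradient grad_step_minimizes)
  moreover have "f y + grad f y \<bullet> (x - y) + \<mu> / 2 * (norm (x - y))\<^sup>2 \<le> f x"
    using assms by (intro strongly_convex_imp_above_paraboloid)
  moreover have "grad f y \<bullet> (x - y) - grad f y \<bullet> (x - T) = grad f y \<bullet> (T - y)"
    by (simp add: inner_simps)
  moreover have "r \<bullet> (x - T) = r \<bullet> (x - y) + L * (norm (T - y))\<^sup>2"
    unfolding r power2_norm_eq_inner by (simp add: inner_simps inner_commute algebra_simps)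
  moreover have "1 / (2 * L) * (norm r)\<^sup>2 = L / 2 * (norm (T - y))\<^sup>2"
    using \<open>0 < L\<close> by (simp add: r norm_minus_commute power2_eq_square)
  moreover have "L * (norm (T - y))\<^sup>2 = L / 2 * (norm (T - y))\<^sup>2 + L / 2 * (norm (T - y))\<^sup>2"
    by simp
  ultimately show ?thesis
    using upper unfolding inner_diff_left by linarith
qed

text \<open>
  The bound \<open>1 - a \<le> exp (- a)\<close> on each factor turns the divergent sum into decay of the product.
\<close>
lemma damping_product_tendsto_0:
  fixes a c :: "nat \<Rightarrow> real"
  assumes a: "\<And>k. a k \<le> 1" and div: "filterlim (\<lambda>N. \<Sum>k<N. a k) at_top sequentially"
    and c: "0 \<le> c 0" "\<And>k. c (Suc k) = (1 - a k) * c k"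
  shows "c \<longlonglongrightarrow> 0"
proof -
  have nonneg: "0 \<le> c k" for k
    using a c by (induction k) auto
  have bound: "c k \<le> c 0 * exp (- (\<Sum>i<k. a i))" for k
  proof (induction k)
    case (Suc k)
    have "1 - a k \<le> exp (- a k)"
      using exp_ge_add_one_self[of "- a k"] by simp
    then have "(1 - a k) * c k \<le> exp (- a k) * (c 0 * exp (- (\<Sum>i<k. a i)))"
      using Suc nonneg by (intro mult_mono) auto
    also have "\<dots> = c 0 * exp (- (\<Sum>i<Suc k. a i))"
      by (simp add: exp_add[symmetric] mult.left_commute)
    finally show ?case
      by (simp add: c)
  qed simp
  have "(\<lambda>k. exp (- (\<Sum>i<k. a i))) \<longlonglongrightarrow> 0"
    by (rule filterlim_compose[OF exp_at_bot])
      (use div in \<open>simp add: filterlim_uminus_at_bot\<close>)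
  then have "(\<lambda>k. c 0 * exp (- (\<Sum>i<k. a i))) \<longlonglongrightarrow> 0"
    by (rule tendsto_mult_right_zero)
  then show ?thesis
    by (rule tendsto_sandwich[where f = "\<lambda>_. 0", rotated 3])
      (simp_all add: nonneg bound)
qed

text \<open>
  Each averaging step multiplies the weight of \<open>\<phi> 0\<close> by \<open>1 - a k\<close> and hands the lost weight to \<open>F\<close>;
  the weight left after \<open>k\<close> steps is \<open>lam k\<close>, and it vanishes because the sum of the \<open>a k\<close> diverges.
\<close>
lemma averaging_imp_estimating_sequences:
  assumes a: "\<And>k. a k \<le> 1" and div: "filterlim (\<lambda>N. \<Sum>k<N. a k) at_top sequentially"
    and lam: "lam 0 = 1" "\<And>k. lam (Suc k) = (1 - a k) * lam k"
    and avg: "\<And>k x. \<phi> (Suc k) x \<le> (1 - a k) * \<phi> k x + a k * F x"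
  shows "estimating_sequences \<phi> lam F"
proof -
  have "0 \<le> lam k" for k
    using a lam by (induction k) auto
  moreover have "lam \<longlonglongrightarrow> 0"
    using a div lam by (intro damping_product_tendsto_0) auto
  moreover have "\<phi> k x \<le> lam k * \<phi> 0 x + (1 - lam k) * F x" for k x
  proof (induction k)
    case (Suc k)
    have "\<phi> (Suc k) x \<le> (1 - a k) * \<phi> k x + a k * F x"
      by (rule avg)
    also have "\<dots> \<le> (1 - a k) * (lam k * \<phi> 0 x + (1 - lam k) * F x) + a k * F x"
      using Suc a by (intro add_right_mono mult_left_mono) auto
    also have "\<dots> = lam (Suc k) * \<phi> 0 x + (1 - lam (Suc k)) * F x"
      by (simp add: lam algebra_simps)
    finally show ?case .
  qed (simp add: lam)
  ultimately show ?thesis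
    unfolding estimating_sequences_def by blast
qed

theorem lemma2:
  fixes f g F :: "real ^ 'n \<Rightarrow> real"
    and \<tau> L\<^sub>f \<mu>\<^sub>f :: real
    and \<alpha> L lam :: "nat \<Rightarrow> real"
    and y :: "nat \<Rightarrow> real ^ 'n"
    and \<phi> :: "nat \<Rightarrow> real ^ 'n \<Rightarrow> real"
  assumes "\<tau> > 0"
    and "0 \<le> \<mu>\<^sub>f" and "\<mu>\<^sub>f \<le> L\<^sub>f"
    and "smooth_with L\<^sub>f f" and "strongly_convex \<mu>\<^sub>f f"
    and "convex_on UNIV g" and "lower_semicontinuous g"
    and "\<And>x. F x = f x + \<tau> * g x"
    and "\<And>k. 0 < \<alpha> k \<and> \<alpha> k < 1"
    and "filterlim (\<lambda>N. \<Sum>k<N. \<alpha> k) at_top sequentially"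
    and "\<And>k. L k > 0"
    and "\<And>k. f (grad_step f \<tau> g (L k) (y k))
            \<le> f (y k) + grad f (y k) \<bullet> (grad_step f \<tau> g (L k) (y k) - y k)
               + L k / 2 * (norm (grad_step f \<tau> g (L k) (y k) - y k))\<^sup>2"
    and "lam 0 = 1"
    and "\<And>k. lam (Suc k) = (1 - \<alpha> k) * lam k"
    and "\<And>k x. \<phi> (Suc k) x = (1 - \<alpha> k) * \<phi> k x
            + \<alpha> k * (F (grad_step f \<tau> g (L k) (y k))
                     + 1 / (2 * L k) * (norm (reduced_grad f \<tau> g (L k) (y k)))\<^sup>2)
            + \<alpha> k * (reduced_grad f \<tau> g (L k) (y k) \<bullet> (x - y k)
                     + \<mu>\<^sub>f / 2 * (norm (x - y k))\<^sup>2)"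
  shows "estimating_sequences \<phi> lam F"
proof -
  have avg: "\<phi> (Suc k) x \<le> (1 - \<alpha> k) * \<phi> k x + \<alpha> k * F x" for k x
  proof -
    let ?T = "grad_step f \<tau> g (L k) (y k)"
    let ?r = "reduced_grad f \<tau> g (L k) (y k)"
    let ?l = "F ?T + 1 / (2 * L k) * (norm ?r)\<^sup>2
        + (?r \<bullet> (x - y k) + \<mu>\<^sub>f / 2 * (norm (x - y k))\<^sup>2)"
    have "f differentiable (at (y k))"
      using assms(4) by (simp add: smooth_with_def)
    then have "?l \<le> F x"
      unfolding assms(8)
      using assms(5,6) less_imp_le[OF assms(1)] assms(11,12)[of k]
      by (rule composite_lower_bound)
    moreover have "0 \<le> \<alpha> k"
      using assms(9)[of k] by simp
    ultimately have "\<alpha> k * ?l \<le> \<alpha> k * F x"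
      by (rule mult_left_mono)
    then show ?thesis
      unfolding assms(15)[of k x] distrib_left by (simp only: add.assoc)
  qed
  have "\<alpha> k \<le> 1" for k
    using assms(9)[of k] by simp
  then show ?thesis
    using assms(10,13,14) avg by (rule averaging_imp_estimating_sequences)
qed

end
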